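(* Let $d, m \geq 1$ be integers, let $\lambda = (\lambda_1, \dots, \lambda_m)$ be a weight, and let $p = -\infty$. Let $\kappa_1, \dots, \kappa_m > 0$, $\omega \geq 0$, $\theta = (\theta_1, \dots, \theta_m) \in (\mathbb{R}^d)^m$, let $s_1, \dots, s_m > 0$ and $s = M_1^\lambda(s_1, \dots, s_m) = \sum_{i=1}^m \lambda_i s_i$, and let $D \subset \mathbb{R}^d$ be a convex set of finite positive Lebesgue measure with indicator function $\chi_D$. For $i = 1, \dots, m$ define $$f_i(x) = \kappa_i \, \chi_D\left( \frac{x - \theta_i}{s_i} \right), \qquad g_i(x) = \omega \kappa_i \, \chi_D\left( \frac{x - z_\lambda(\theta)}{s} \right) \qquad (x \in \mathbb{R}^d).$$ Put $S = S(f_1) \times \dots \times S(f_m)$ and $$K = \operatorname*{ess\,inf}_{x = (x_1, \dots, x_m) \in S} M_p^\lambda \left( \frac{g_1(z_\lambda(x))}{f_1(x_1)}, \dots, \frac{g_m(z_\lambda(x))}{f_m(x_m)} \right),$$ the essential infimum being with respect to Lebesgue measure on $S$. Then $$K = M_{Q_d(p)}^\lambda \left( \frac{\| g_1 \|_1}{\| f_1 \|_1}, \dots, \frac{\| g_m \|_1}{\| f_m \|_1} \right) = \omega.$$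
   Context: A weight is a tuple $\lambda = (\lambda_1, \dots, \lambda_m)$ of positive real numbers with $\sum_{i=1}^m \lambda_i = 1$. For a weight $\lambda$ and $-\infty \leq p \leq \infty$, the weighted power mean $M_p^\lambda \colon \mathbb{R}_{\geq 0}^m \to \mathbb{R}_{\geq 0}$ is defined by: $M_0^\lambda(a) = \prod_{i=1}^m a_i^{\lambda_i}$; $M_{-\infty}^\lambda(a) = \min_i a_i$; $M_\infty^\lambda(a) = \max_i a_i$; $M_p^\lambda(a) = 0$ if $-\infty \leq p \leq 0$ and $\prod_{i=1}^m a_i = 0$; and $M_p^\lambda(a) = \left( \sum_{i=1}^m \lambda_i a_i^p \right)^{1/p}$ otherwise. For $x = (x_1, \dots, x_m) \in (\mathbb{R}^d)^m$, $z_\lambda(x) = \sum_{i=1}^m \lambda_i x_i \in \mathbb{R}^d$. For $f \colon \mathbb{R}^d \to \mathbb{R}_{\geq 0}$, $S(f) = \{ x \in \mathbb{R}^d \mid f(x) > 0 \}$, and $\| f \|_1$ is the $L^1$ norm with respect to Lebesgue measure. The power transform $Q_d \colon [-\infty, 1/d] \to [-\infty, \infty]$ is $Q_d(p) = \frac{p}{1 - dp}$ for $-\infty < p < 1/d$, $Q_d(-\infty) = -1/d$, and $Q_d(1/d) = \infty$. *)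

theory Defs
  imports "HOL-Analysis.Analysis" "HOL-Probability.Essential_Supremum"
begin

definition weight :: "real ^ 'm \<Rightarrow> bool" where
  "weight w \<longleftrightarrow> (\<forall>i. 0 < w $ i) \<and> (\<Sum>i\<in>UNIV. w $ i) = 1"

(* Only meant for entrywise nonnegative a and for a weight w. In the last case either p > 0,
   or all entries of a are positive. *)
definition power_mean :: "real ^ 'm \<Rightarrow> ereal \<Rightarrow> real ^ 'm \<Rightarrow> real" where
  "power_mean w p a =
    (if p = 0 then \<Prod>i\<in>UNIV. (a $ i) powr (w $ i)
     else if p = -\<infinity> then Min (range (($) a))
     else if p = \<infinity> then Max (range (($) a))
     else if p \<le> 0 \<and> (\<Prod>i\<in>UNIV. a $ i) = 0 then 0
     else (\<Sum>i\<in>UNIV. w $ i * (a $ i) powr real_of_ereal p) powr (1 / real_of_ereal p))"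

definition weighted_sum :: "real ^ 'm \<Rightarrow> real ^ 'd ^ 'm \<Rightarrow> real ^ 'd" where
  "weighted_sum w x = (\<Sum>i\<in>UNIV. w $ i *\<^sub>R x $ i)"

definition pos_set :: "(real ^ 'd \<Rightarrow> real) \<Rightarrow> (real ^ 'd) set" where
  "pos_set f = {x. f x > 0}"

(* The Bochner integral is 0 when f is not integrable, so this is only meant for f in L^1. *)
definition L1_norm :: "(real ^ 'd \<Rightarrow> real) \<Rightarrow> real" where
  "L1_norm f = (\<integral>x. \<bar>f x\<bar> \<partial>lebesgue)"

definition power_transform :: "nat \<Rightarrow> ereal \<Rightarrow> ereal" where
  "power_transform d p =
    (if p = -\<infinity> then ereal (- 1 / real d)
     else if p < ereal (1 / real d) then ereal (real_of_ereal p / (1 - real d * real_of_ereal p))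
     else if p = ereal (1 / real d) then \<infinity>
     else undefined)"

definition ess_inf :: "'a measure \<Rightarrow> ('a \<Rightarrow> ereal) \<Rightarrow> ereal" where
  "ess_inf M f = Sup {c. AE x in M. c \<le> f x}"

lemma ess_inf_eq_uminus_esssup:
  assumes [measurable]: "f \<in> borel_measurable M"
  shows "ess_inf M f = - esssup M (\<lambda>x. - f x)"
proof (rule antisym)
  show "ess_inf M f \<le> - esssup M (\<lambda>x. - f x)"
    unfolding ess_inf_def
  proof (rule Sup_least)
    fix c assume "c \<in> {c. AE x in M. c \<le> f x}"
    then have "AE x in M. - f x \<le> - c" by simp
    then have "esssup M (\<lambda>x. - f x) \<le> - c" by (intro esssup_I) measurable
    then have "- (- c) \<le> - esssup M (\<lambda>x. - f x)" by (simp only: ereal_minus_le_minus)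
    then show "c \<le> - esssup M (\<lambda>x. - f x)" by simp
  qed
  have "AE x in M. - f x \<le> esssup M (\<lambda>x. - f x)" by (rule esssup_AE)
  then have "AE x in M. - esssup M (\<lambda>x. - f x) \<le> f x"
    by (rule AE_mp) (auto simp: ereal_uminus_le_reorder)
  then show "- esssup M (\<lambda>x. - f x) \<le> ess_inf M f"
    unfolding ess_inf_def by (intro Sup_upper) simp
qed

lemma power_mean_1:
  assumes "\<And>i. 0 \<le> w $ i" "\<And>i. 0 \<le> a $ i"
  shows "power_mean w 1 a = (\<Sum>i\<in>UNIV. w $ i * a $ i)"
  using assms by (simp add: power_mean_def sum_nonneg)

end

theory Submission
  imports Defs
begin

text \<open>
  On \<open>S\<close> the points \<open>(x\<^sub>i - \<theta>\<^sub>i) / s\<^sub>i\<close> lie in \<open>D\<close>, and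
  \<open>(z\<^sub>\<lambda>(x) - z\<^sub>\<lambda>(\<theta>)) / s\<close> is a convex combination of them with coefficients \<open>\<lambda>\<^sub>i s\<^sub>i / s\<close>.
  Hence every ratio \<open>g\<^sub>i / f\<^sub>i\<close> equals \<open>\<omega>\<close> on \<open>S\<close>, and \<open>S\<close> is not a null set because
  \<open>D\<close> has an interior point. The ratios of the norms are \<open>\<omega> (s / s\<^sub>i)\<^sup>d\<close>, whose power mean
  of order \<open>-1/d\<close> is \<open>\<omega>\<close> since \<open>s\<close> is the weighted arithmetic mean of the \<open>s\<^sub>i\<close>.
\<close>

text \<open>The frontier of a convex set is negligible, so the set is its open interior together
  with a null set. This supplies the measurability of \<open>S\<close> and of the affine images of
  \<open>D\<close>.\<close>

lemma sets_lebesgue_convex: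
  fixes C :: "'a::euclidean_space set"
  assumes "convex C"
  shows "C \<in> sets lebesgue"
proof -
  have "C - interior C \<subseteq> frontier C"
    using closure_subset by (auto simp: frontier_def)
  then have "negligible (C - interior C)"
    using negligible_convex_frontier[OF assms] negligible_subset by blast
  then have "C - interior C \<in> sets lebesgue"
    by (simp add: negligible_imp_sets)
  moreover have "C = interior C \<union> (C - interior C)"
    using interior_subset by blast
  ultimately show ?thesis
    by (metis lebesgue_openin open_interior open_openin sets.Un sets_completionI_sets sets_lborel borel_open)
qed

text \<open>On a space of nonzero measure a constant inequality that holds almost everywhere is
  true, so the essential lower bounds are exactly \<open>{..c}\<close>. On a null space every bound
  would qualify and the value would be \<infinity>.\<close>

lemma ess_inf_eq_const:
  assumes "emeasure M (space M) \<noteq> 0" and "\<And>x. x \<in> space M \<Longrightarrow> f x = c"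
  shows "ess_inf M f = c"
proof -
  have "(AE x in M. b \<le> f x) \<longleftrightarrow> b \<le> c" for b
  proof -
    have "(AE x in M. b \<le> f x) \<longleftrightarrow> (AE x in M. b \<le> c)"
      using assms(2) by (intro AE_cong) simp
    also have "\<dots> \<longleftrightarrow> b \<le> c"
      using assms(1) by (auto simp: ae_filter_eq_bot_iff)
    finally show ?thesis .
  qed
  then have "ess_inf M f = Sup {..c}"
    by (simp add: ess_inf_def atMost_def)
  then show ?thesis by simp
qed

text \<open>A finite product of open sets is open, so the product of the interiors lies in the
  interior of the product. This shows that \<open>S\<close> is not null without computing a product
  measure.\<close>

lemma interior_vec_pointwise_nonempty:
  fixes A :: "'m::finite \<Rightarrow> (real ^ 'd) set"
  assumes "\<And>i. interior (A i) \<noteq> {}"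
  shows "interior {x. \<forall>i. x $ i \<in> A i} \<noteq> {}"
proof -
  let ?U = "{x::real ^ 'd ^ 'm. \<forall>i. x $ i \<in> interior (A i)}"
  have "open ?U"
    by (intro open_vector_box) auto
  moreover have "?U \<subseteq> {x. \<forall>i. x $ i \<in> A i}"
    using interior_subset by blast
  ultimately have "?U \<subseteq> interior {x. \<forall>i. x $ i \<in> A i}"
    by (simp add: interior_maximal)
  moreover obtain y where "\<forall>i. y i \<in> interior (A i)"
    using assms choice[of "\<lambda>i v. v \<in> interior (A i)"] by blast
  then have "(\<chi> i. y i) \<in> ?U" by simp
  ultimately show ?thesis by blast
qed

lemma mem_affine_image_iff:
  fixes c x :: "'a::real_vector"
  assumes "t \<noteq> 0"
  shows "x \<in> (\<lambda>y. t *\<^sub>R y + c) ` D \<longleftrightarrow> (x - c) /\<^sub>R t \<in> D"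
  using assms by (auto simp: image_iff intro!: bexI[of _ "(x - c) /\<^sub>R t"])

text \<open>The function is \<open>a\<close> times the indicator of the image of \<open>D\<close>
  under \<open>y \<mapsto> t y + c\<close>, whose measure is scaled by \<open>t ^ d\<close>.
  Convexity makes this image measurable.\<close>

lemma L1_norm_indicator_affine:
  fixes D :: "(real ^ 'd) set"
  assumes "convex D" "t > 0" "a \<ge> 0"
  shows "L1_norm (\<lambda>x. a * indicator D ((x - c) /\<^sub>R t)) = a * t ^ CARD('d) * measure lebesgue D"
proof -
  let ?B = "(\<lambda>y. t *\<^sub>R y + c) ` D"
  have "?B = (\<lambda>y. c + y) ` ((\<lambda>y. t *\<^sub>R y) ` D)"
    by (auto simp: image_image add.commute)
  then have "convex ?B"
    using assms(1) by (simp add: convex_translation convex_scaling)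
  then have [simp]: "?B \<in> sets lebesgue" by (rule sets_lebesgue_convex)
  have "L1_norm (\<lambda>x. a * indicator D ((x - c) /\<^sub>R t)) = (\<integral>x. a * indicator ?B x \<partial>lebesgue)"
    using assms by (simp add: L1_norm_def abs_mult indicator_def mem_affine_image_iff)
  also have "\<dots> = a * measure lebesgue ?B" by simp
  also have "\<dots> = a * t ^ CARD('d) * measure lebesgue D"
    using assms by (simp add: measure_lebesgue_affine)
  finally show ?thesis .
qed

text \<open>The power \<open>-1/d\<close> undoes the exponent \<open>d\<close> and inverts the
  quotient, so each entry becomes linear in \<open>\<sigma> $ i\<close>. The weighted sum then
  produces \<open>s\<close>, which cancels.\<close>

lemma power_mean_neg_inverse_scaled:
  fixes w \<sigma> :: "real ^ 'm"
  assumes "weight w" "\<And>i. \<sigma> $ i > 0" "\<omega> \<ge> 0" "d > 0"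
    and s: "s = (\<Sum>i\<in>UNIV. w $ i * \<sigma> $ i)"
  shows "power_mean w (ereal (- 1 / real d)) (\<chi> i. \<omega> * (s / \<sigma> $ i) ^ d) = \<omega>"
proof -
  have w: "w $ i > 0" for i using assms(1) by (simp add: weight_def)
  have "s > 0" unfolding s using w assms(2) by (intro sum_pos) auto
  show ?thesis
  proof (cases "\<omega> = 0")
    case True
    \<comment> \<open>All entries vanish, so the clause for orders \<le> 0 with zero product returns
      0.\<close>
    then show ?thesis using \<open>d > 0\<close> by (simp add: power_mean_def)
  next
    case False
    then have "\<omega> > 0" using assms(3) by simp
    have pos: "\<omega> * (s / \<sigma> $ i) ^ d > 0" for i
      using \<open>\<omega> > 0\<close> \<open>s > 0\<close> assms(2) by simp
    have root: "(\<omega> * (s / \<sigma> $ i) ^ d) powr (- 1 / real d)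
        = \<omega> powr (- 1 / real d) / s * \<sigma> $ i" for i
    proof -
      have q: "s / \<sigma> $ i > 0" using \<open>s > 0\<close> assms(2) by simp
      have "((s / \<sigma> $ i) ^ d) powr (- 1 / real d) = (s / \<sigma> $ i) powr (- 1)"
        using q \<open>d > 0\<close> by (simp add: powr_realpow[symmetric] powr_powr)
      also have "\<dots> = \<sigma> $ i / s"
        using \<open>s > 0\<close> assms(2)[of i] by (simp add: powr_minus)
      finally show ?thesis
        using q \<open>\<omega> > 0\<close> by (simp add: powr_mult)
    qed
    have "(\<Sum>i\<in>UNIV. w $ i * (\<omega> * (s / \<sigma> $ i) ^ d) powr (- 1 / real d))
        = \<omega> powr (- 1 / real d) / s * (\<Sum>i\<in>UNIV. w $ i * \<sigma> $ i)"
      unfolding root by (simp add: sum_distrib_left mult_ac)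
    also have "\<dots> = \<omega> powr (- 1 / real d)"
      using \<open>s > 0\<close> by (simp add: s[symmetric])
    finally have sum: "(\<Sum>i\<in>UNIV. w $ i * (\<omega> * (s / \<sigma> $ i) ^ d) powr (- 1 / real d))
        = \<omega> powr (- 1 / real d)" .
    \<comment> \<open>This rules out the zero clause of \<open>power_mean\<close>, so the sum
      formula applies.\<close>
    have "(\<Prod>i\<in>UNIV. \<omega> * (s / \<sigma> $ i) ^ d) \<noteq> 0"
      using pos by (metis (no_types, lifting) less_irrefl prod_pos)
    then have "power_mean w (ereal (- 1 / real d)) (\<chi> i. \<omega> * (s / \<sigma> $ i) ^ d)
        = (\<omega> powr (- 1 / real d)) powr (1 / (- 1 / real d))"
      using \<open>d > 0\<close> sum by (simp add: power_mean_def)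
    also have "\<dots> = \<omega>"
      using \<open>d > 0\<close> \<open>\<omega> > 0\<close> by (simp add: powr_powr)
    finally show ?thesis .
  qed
qed

text \<open>The coefficients \<open>w $ i * \<sigma> $ i / s\<close> sum to 1 by the choice of
  \<open>s\<close>, and their factor \<open>\<sigma> $ i\<close> cancels the rescaling of the i-th
  point.\<close>

lemma weighted_sum_rescaled_mem_convex:
  fixes w \<sigma> :: "real ^ 'm" and x \<theta> :: "real ^ 'd ^ 'm"
  assumes "\<And>i. w $ i > 0" "\<And>i. \<sigma> $ i > 0" "convex D"
    and s: "s = (\<Sum>i\<in>UNIV. w $ i * \<sigma> $ i)"
    and mem: "\<And>i. (x $ i - \<theta> $ i) /\<^sub>R \<sigma> $ i \<in> D"
  shows "(weighted_sum w x - weighted_sum w \<theta>) /\<^sub>R s \<in> D"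
proof -
  have "s > 0" unfolding s using assms by (intro sum_pos) auto
  have "(\<Sum>i\<in>UNIV. (w $ i * \<sigma> $ i / s) *\<^sub>R ((x $ i - \<theta> $ i) /\<^sub>R \<sigma> $ i)) \<in> D"
  proof (rule convex_sum)
    show "(\<Sum>i\<in>UNIV. w $ i * \<sigma> $ i / s) = 1"
      using \<open>s > 0\<close> by (simp add: sum_divide_distrib[symmetric] s[symmetric])
    show "0 \<le> w $ i * \<sigma> $ i / s" for i
      using \<open>s > 0\<close> assms by (simp add: less_imp_le)
  qed (use assms in auto)
  also have "(\<Sum>i\<in>UNIV. (w $ i * \<sigma> $ i / s) *\<^sub>R ((x $ i - \<theta> $ i) /\<^sub>R \<sigma> $ i))
      = (\<Sum>i\<in>UNIV. (w $ i *\<^sub>R (x $ i - \<theta> $ i)) /\<^sub>R s)"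
    using assms(2) by (intro sum.cong) (auto simp: field_simps less_imp_neq[symmetric])
  also have "\<dots> = (weighted_sum w x - weighted_sum w \<theta>) /\<^sub>R s"
    by (simp add: weighted_sum_def scaleR_sum_right sum_subtractf scaleR_diff_right)
  finally show ?thesis .
qed

theorem proposition6p5:
  fixes w \<kappa> \<sigma> :: "real ^ 'm"
    and \<theta> :: "real ^ 'd ^ 'm"
    and \<omega> s :: real
    and p K :: ereal
    and D :: "(real ^ 'd) set"
    and f g :: "'m \<Rightarrow> real ^ 'd \<Rightarrow> real"
    and S :: "(real ^ 'd ^ 'm) set"
  assumes "weight w"
    and "p = -\<infinity>"
    and "\<And>i. \<kappa> $ i > 0"
    and "\<omega> \<ge> 0"
    and "\<And>i. \<sigma> $ i > 0"
    and "s = power_mean w 1 \<sigma>"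
    and "convex D" and "0 < emeasure lebesgue D" and "emeasure lebesgue D < \<infinity>"
    and "\<And>i x. f i x = \<kappa> $ i * indicator D ((x - \<theta> $ i) /\<^sub>R \<sigma> $ i)"
    and "\<And>i x. g i x = \<omega> * \<kappa> $ i * indicator D ((x - weighted_sum w \<theta>) /\<^sub>R s)"
    and "S = {x. \<forall>i. x $ i \<in> pos_set (f i)}"
    and "K = ess_inf (lebesgue_on S)
               (\<lambda>x. ereal (power_mean w p (\<chi> i. g i (weighted_sum w x) / f i (x $ i))))"
  shows "K = ereal (power_mean w (power_transform CARD('d) p)
                      (\<chi> i. L1_norm (g i) / L1_norm (f i)))
       \<and> power_mean w (power_transform CARD('d) p)
           (\<chi> i. L1_norm (g i) / L1_norm (f i)) = \<omega>"
proof -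
  note \<kappa> = assms(3) and \<sigma> = assms(5) and D = assms(7-9) and f = assms(10) and g = assms(11)
  have w: "w $ i > 0" for i using assms(1) by (simp add: weight_def)
  have s: "s = (\<Sum>i\<in>UNIV. w $ i * \<sigma> $ i)"
    unfolding assms(6) using w \<sigma> by (intro power_mean_1) (simp_all add: less_imp_le)
  have "s > 0" unfolding s using w \<sigma> by (intro sum_pos) auto

  have pos_set_f: "pos_set (f i) = (\<lambda>y. \<sigma> $ i *\<^sub>R y + \<theta> $ i) ` D" for i
  proof (rule set_eqI)
    have "\<sigma> $ i \<noteq> 0" using \<sigma>[of i] by simp
    then show "x \<in> pos_set (f i) \<longleftrightarrow> x \<in> (\<lambda>y. \<sigma> $ i *\<^sub>R y + \<theta> $ i) ` D" for x
      unfolding mem_affine_image_iff[OF \<open>\<sigma> $ i \<noteq> 0\<close>]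
      using \<kappa>[of i] by (simp add: pos_set_def f indicator_def)
  qed
  have "convex (pos_set (f i))" for i
  proof -
    have "pos_set (f i) = (\<lambda>y. \<theta> $ i + y) ` ((\<lambda>y. \<sigma> $ i *\<^sub>R y) ` D)"
      by (auto simp: pos_set_f image_image add.commute)
    then show ?thesis
      using D(1) by (simp add: convex_translation convex_scaling)
  qed
  then have "convex S"
    unfolding assms(12) by (auto simp: convex_def)
  have "emeasure lebesgue (pos_set (f i)) \<noteq> 0" for i
    using D(2) \<sigma>[of i] by (simp add: pos_set_f emeasure_lebesgue_affine)
  then have "\<not> negligible (pos_set (f i))" for i
    by (auto simp: negligible_iff_null_sets)
  \<comment> \<open>A convex set with empty interior is negligible. Positive measure of each factor
    thus becomes an interior point, which passes to the product.\<close>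
  then have "interior (pos_set (f i)) \<noteq> {}" for i
    using \<open>\<And>i. convex (pos_set (f i))\<close> negligible_convex_interior by blast
  then have "interior S \<noteq> {}"
    unfolding assms(12) by (rule interior_vec_pointwise_nonempty)
  then have "\<not> negligible S"
    using \<open>convex S\<close> negligible_convex_interior by blast
  then have "emeasure (lebesgue_on S) (space (lebesgue_on S)) \<noteq> 0"
    using sets_lebesgue_convex[OF \<open>convex S\<close>]
    by (auto simp: negligible_iff_null_sets emeasure_restrict_space null_sets_def)
  moreover have "ereal (power_mean w p (\<chi> i. g i (weighted_sum w x) / f i (x $ i))) = ereal \<omega>"
    if "x \<in> space (lebesgue_on S)" for x
  proof -
    have mem: "(x $ i - \<theta> $ i) /\<^sub>R \<sigma> $ i \<in> D" for i
    proof -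
      have "f i (x $ i) > 0" using that by (simp add: assms(12) pos_set_def)
      then show ?thesis by (auto simp: f indicator_def of_bool_def split: if_splits)
    qed
    then have "(weighted_sum w x - weighted_sum w \<theta>) /\<^sub>R s \<in> D"
      using weighted_sum_rescaled_mem_convex[OF w \<sigma> D(1) s] by blast
    then have "g i (weighted_sum w x) / f i (x $ i) = \<omega>" for i
      using \<kappa>[of i] mem[of i] by (simp add: f g)
    \<comment> \<open>For \<open>p = -\<infinity>\<close> the mean is the minimum, here of a
      constant family.\<close>
    then show ?thesis by (simp add: power_mean_def assms(2))
  qed
  ultimately have K: "K = ereal \<omega>"
    unfolding assms(13) by (rule ess_inf_eq_const)

  \<comment> \<open>Finiteness of the measure matters: \<open>measure\<close> is 0 on sets of
    infinite measure.\<close>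
  have "measure lebesgue D > 0"
    using D by (simp add: measure_def enn2real_positive_iff)
  moreover have "L1_norm (f i) = \<kappa> $ i * \<sigma> $ i ^ CARD('d) * measure lebesgue D" for i
    using L1_norm_indicator_affine[OF D(1) \<sigma>[of i], of "\<kappa> $ i" "\<theta> $ i"] \<kappa>[of i]
    by (simp add: f[abs_def])
  moreover have "L1_norm (g i) = \<omega> * \<kappa> $ i * s ^ CARD('d) * measure lebesgue D" for i
    using L1_norm_indicator_affine[OF D(1) \<open>s > 0\<close>, of "\<omega> * \<kappa> $ i" "weighted_sum w \<theta>"] \<kappa>[of i] assms(4)
    by (simp add: g[abs_def])
  \<comment> \<open>The factors \<open>\<kappa> $ i\<close> and the measure of \<open>D\<close>
    cancel, both being nonzero.\<close>
  ultimately have "L1_norm (g i) / L1_norm (f i) = \<omega> * (s / \<sigma> $ i) ^ CARD('d)" for i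
    using \<kappa>[of i] by (simp add: power_divide)
  then have "power_mean w (power_transform CARD('d) p) (\<chi> i. L1_norm (g i) / L1_norm (f i)) = \<omega>"
    using power_mean_neg_inverse_scaled[OF assms(1) \<sigma> assms(4) zero_less_card_finite s, where 'a1='d]
    by (simp add: power_transform_def assms(2))
  then show ?thesis using K by simp
qed

end
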